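(* Let $(\mathcal{C},\mathbb{E},\mathfrak{s})$ be an extriangulated category. Then the poset of torsion pairs in $\mathcal{C}$ is a lattice.
   Context: Extriangulated categories are in the sense of Nakaoka–Palu. A pair $(\mathcal{T},\mathcal{F})$ of full subcategories of $\mathcal{C}$ is a torsion pair if: $\operatorname{Hom}(t,\mathcal{F})=0$ if and only if $t\in\mathcal{T}$; and $\operatorname{Hom}(\mathcal{T},f)=0$ if and only if $f\in\mathcal{F}$. Torsion pairs are ordered by $(\mathcal{T}_1,\mathcal{F}_1)\preceq(\mathcal{T}_2,\mathcal{F}_2)\iff\mathcal{T}_1\subseteq\mathcal{T}_2\iff\mathcal{F}_1\supseteq\mathcal{F}_2$. A lattice is a poset in which any two elements have a meet and a join. *)

theory Defs
  imports "HOL-Algebra.Group"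
begin

section \<open>Additive categories\<close>

text \<open>
  The abelian group of morphisms from \<open>A\<close> to \<open>B\<close> is \<open>Hom \<C> A B\<close>. Its group law is the
  addition of morphisms, although the group records of \<open>HOL-Algebra\<close> write it multiplicatively:
  \<open>\<otimes>\<close> is the sum and \<open>\<one>\<close> is the zero morphism. The same applies to the groups
  \<open>Ext \<E> C A\<close> below.
\<close>

record ('o, 'm) precat =
  Obj :: "'o set"
  Hom :: "'o \<Rightarrow> 'o \<Rightarrow> 'm monoid"
  ident :: "'o \<Rightarrow> 'm"
  cmp :: "'m \<Rightarrow> 'm \<Rightarrow> 'm" (infixr \<open>\<cdot>\<index>\<close> 75)

definition zero_object :: "('o, 'm) precat \<Rightarrow> 'o \<Rightarrow> bool" where
  "zero_object \<C> Z \<longleftrightarrow> Z \<in> Obj \<C> \<and>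
     (\<forall>A \<in> Obj \<C>. (\<exists>!f. f \<in> carrier (Hom \<C> A Z)) \<and> (\<exists>!f. f \<in> carrier (Hom \<C> Z A)))"

definition biproduct ::
  "('o, 'm) precat \<Rightarrow> 'o \<Rightarrow> 'o \<Rightarrow> 'o \<Rightarrow> 'm \<Rightarrow> 'm \<Rightarrow> 'm \<Rightarrow> 'm \<Rightarrow> bool" where
  "biproduct \<C> A\<^sub>1 A\<^sub>2 P i\<^sub>1 i\<^sub>2 p\<^sub>1 p\<^sub>2 \<longleftrightarrow>
     A\<^sub>1 \<in> Obj \<C> \<and> A\<^sub>2 \<in> Obj \<C> \<and> P \<in> Obj \<C> \<and>
     i\<^sub>1 \<in> carrier (Hom \<C> A\<^sub>1 P) \<and> i\<^sub>2 \<in> carrier (Hom \<C> A\<^sub>2 P) \<and>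
     p\<^sub>1 \<in> carrier (Hom \<C> P A\<^sub>1) \<and> p\<^sub>2 \<in> carrier (Hom \<C> P A\<^sub>2) \<and>
     p\<^sub>1 \<cdot>\<^bsub>\<C>\<^esub> i\<^sub>1 = ident \<C> A\<^sub>1 \<and> p\<^sub>2 \<cdot>\<^bsub>\<C>\<^esub> i\<^sub>2 = ident \<C> A\<^sub>2 \<and>
     p\<^sub>1 \<cdot>\<^bsub>\<C>\<^esub> i\<^sub>2 = \<one>\<^bsub>Hom \<C> A\<^sub>2 A\<^sub>1\<^esub> \<and> p\<^sub>2 \<cdot>\<^bsub>\<C>\<^esub> i\<^sub>1 = \<one>\<^bsub>Hom \<C> A\<^sub>1 A\<^sub>2\<^esub> \<and>
     (i\<^sub>1 \<cdot>\<^bsub>\<C>\<^esub> p\<^sub>1) \<otimes>\<^bsub>Hom \<C> P P\<^esub> (i\<^sub>2 \<cdot>\<^bsub>\<C>\<^esub> p\<^sub>2) = ident \<C> P"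

definition isos :: "('o, 'm) precat \<Rightarrow> 'o \<Rightarrow> 'o \<Rightarrow> 'm set" where
  "isos \<C> A B = {f \<in> carrier (Hom \<C> A B).
     \<exists>g \<in> carrier (Hom \<C> B A). g \<cdot>\<^bsub>\<C>\<^esub> f = ident \<C> A \<and> f \<cdot>\<^bsub>\<C>\<^esub> g = ident \<C> B}"

locale preadditive_category =
  fixes \<C> :: "('o, 'm) precat" (structure)
  assumes Hom_comm_group:
      "\<lbrakk>A \<in> Obj \<C>; B \<in> Obj \<C>\<rbrakk> \<Longrightarrow> comm_group (Hom \<C> A B)"
    and Hom_disjoint:
      "\<lbrakk>A \<in> Obj \<C>; B \<in> Obj \<C>; A' \<in> Obj \<C>; B' \<in> Obj \<C>;
        f \<in> carrier (Hom \<C> A B); f \<in> carrier (Hom \<C> A' B')\<rbrakk> \<Longrightarrow> A = A' \<and> B = B'"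
    and ident_closed:
      "A \<in> Obj \<C> \<Longrightarrow> ident \<C> A \<in> carrier (Hom \<C> A A)"
    and cmp_closed:
      "\<lbrakk>A \<in> Obj \<C>; B \<in> Obj \<C>; C \<in> Obj \<C>;
        f \<in> carrier (Hom \<C> A B); g \<in> carrier (Hom \<C> B C)\<rbrakk> \<Longrightarrow> g \<cdot> f \<in> carrier (Hom \<C> A C)"
    and cmp_ident_left:
      "\<lbrakk>A \<in> Obj \<C>; B \<in> Obj \<C>; f \<in> carrier (Hom \<C> A B)\<rbrakk> \<Longrightarrow> ident \<C> B \<cdot> f = f"
    and cmp_ident_right:
      "\<lbrakk>A \<in> Obj \<C>; B \<in> Obj \<C>; f \<in> carrier (Hom \<C> A B)\<rbrakk> \<Longrightarrow> f \<cdot> ident \<C> A = f"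
    and cmp_assoc:
      "\<lbrakk>A \<in> Obj \<C>; B \<in> Obj \<C>; C \<in> Obj \<C>; D \<in> Obj \<C>;
        f \<in> carrier (Hom \<C> A B); g \<in> carrier (Hom \<C> B C); h \<in> carrier (Hom \<C> C D)\<rbrakk>
        \<Longrightarrow> (h \<cdot> g) \<cdot> f = h \<cdot> (g \<cdot> f)"
    and cmp_add_right:
      "\<lbrakk>A \<in> Obj \<C>; B \<in> Obj \<C>; C \<in> Obj \<C>;
        f \<in> carrier (Hom \<C> A B); f' \<in> carrier (Hom \<C> A B); g \<in> carrier (Hom \<C> B C)\<rbrakk>
        \<Longrightarrow> g \<cdot> (f \<otimes>\<^bsub>Hom \<C> A B\<^esub> f') = (g \<cdot> f) \<otimes>\<^bsub>Hom \<C> A C\<^esub> (g \<cdot> f')"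
    and cmp_add_left:
      "\<lbrakk>A \<in> Obj \<C>; B \<in> Obj \<C>; C \<in> Obj \<C>;
        f \<in> carrier (Hom \<C> A B); g \<in> carrier (Hom \<C> B C); g' \<in> carrier (Hom \<C> B C)\<rbrakk>
        \<Longrightarrow> (g \<otimes>\<^bsub>Hom \<C> B C\<^esub> g') \<cdot> f = (g \<cdot> f) \<otimes>\<^bsub>Hom \<C> A C\<^esub> (g' \<cdot> f)"

locale additive_category = preadditive_category +
  assumes ex_zero_object: "\<exists>Z. zero_object \<C> Z"
    and ex_biproduct:
      "\<lbrakk>A \<in> Obj \<C>; B \<in> Obj \<C>\<rbrakk> \<Longrightarrow> \<exists>P i\<^sub>1 i\<^sub>2 p\<^sub>1 p\<^sub>2. biproduct \<C> A B P i\<^sub>1 i\<^sub>2 p\<^sub>1 p\<^sub>2"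


section \<open>Extensions and their realizations\<close>

text \<open>
  The group \<open>\<E>(C, A)\<close> is \<open>Ext \<E> C A\<close>, contravariant in \<open>C\<close> and covariant in \<open>A\<close>; the map
  \<open>\<E>(c, a) : \<E>(C, A) \<rightarrow> \<E>(C', A')\<close> induced by \<open>c : C' \<rightarrow> C\<close> and \<open>a : A \<rightarrow> A'\<close> is \<open>Emap \<E> c a\<close>.
\<close>

record ('o, 'm, 'e) bifun =
  Ext :: "'o \<Rightarrow> 'o \<Rightarrow> 'e monoid"
  Emap :: "'m \<Rightarrow> 'm \<Rightarrow> 'e \<Rightarrow> 'e"

locale additive_bifunctor = additive_category \<C>
  for \<C> :: "('o, 'm) precat" (structure) +
  fixes \<E> :: "('o, 'm, 'e) bifun"
  assumes Ext_comm_group: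
      "\<lbrakk>C \<in> Obj \<C>; A \<in> Obj \<C>\<rbrakk> \<Longrightarrow> comm_group (Ext \<E> C A)"
    and Emap_hom:
      "\<lbrakk>C \<in> Obj \<C>; C' \<in> Obj \<C>; A \<in> Obj \<C>; A' \<in> Obj \<C>;
        c \<in> carrier (Hom \<C> C' C); a \<in> carrier (Hom \<C> A A')\<rbrakk>
        \<Longrightarrow> Emap \<E> c a \<in> hom (Ext \<E> C A) (Ext \<E> C' A')"
    and Emap_ident:
      "\<lbrakk>C \<in> Obj \<C>; A \<in> Obj \<C>; \<delta> \<in> carrier (Ext \<E> C A)\<rbrakk>
        \<Longrightarrow> Emap \<E> (ident \<C> C) (ident \<C> A) \<delta> = \<delta>"
    and Emap_cmp:
      "\<lbrakk>C \<in> Obj \<C>; C' \<in> Obj \<C>; C'' \<in> Obj \<C>; A \<in> Obj \<C>; A' \<in> Obj \<C>; A'' \<in> Obj \<C>;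
        c \<in> carrier (Hom \<C> C' C); c' \<in> carrier (Hom \<C> C'' C');
        a \<in> carrier (Hom \<C> A A'); a' \<in> carrier (Hom \<C> A' A''); \<delta> \<in> carrier (Ext \<E> C A)\<rbrakk>
        \<Longrightarrow> Emap \<E> (c \<cdot> c') (a' \<cdot> a) \<delta> = Emap \<E> c' a' (Emap \<E> c a \<delta>)"
    and Emap_add_left:
      "\<lbrakk>C \<in> Obj \<C>; C' \<in> Obj \<C>; A \<in> Obj \<C>; A' \<in> Obj \<C>;
        c \<in> carrier (Hom \<C> C' C); c' \<in> carrier (Hom \<C> C' C); a \<in> carrier (Hom \<C> A A');
        \<delta> \<in> carrier (Ext \<E> C A)\<rbrakk>
        \<Longrightarrow> Emap \<E> (c \<otimes>\<^bsub>Hom \<C> C' C\<^esub> c') a \<delta> = Emap \<E> c a \<delta> \<otimes>\<^bsub>Ext \<E> C' A'\<^esub> Emap \<E> c' a \<delta>"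
    and Emap_add_right:
      "\<lbrakk>C \<in> Obj \<C>; C' \<in> Obj \<C>; A \<in> Obj \<C>; A' \<in> Obj \<C>;
        c \<in> carrier (Hom \<C> C' C); a \<in> carrier (Hom \<C> A A'); a' \<in> carrier (Hom \<C> A A');
        \<delta> \<in> carrier (Ext \<E> C A)\<rbrakk>
        \<Longrightarrow> Emap \<E> c (a \<otimes>\<^bsub>Hom \<C> A A'\<^esub> a') \<delta> = Emap \<E> c a \<delta> \<otimes>\<^bsub>Ext \<E> C' A'\<^esub> Emap \<E> c a' \<delta>"

text \<open>
  For \<open>\<delta> \<in> \<E>(C, A)\<close>, \<open>push \<C> \<E> C a \<delta>\<close> is \<open>a\<^sub>* \<delta>\<close> and \<open>pull \<C> \<E> A c \<delta>\<close> is \<open>c\<^sup>* \<delta>\<close>. The fixed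
  object is an argument because the groups \<open>\<E>(C, A)\<close> are not required to be disjoint.
\<close>

definition push ::
  "('o, 'm) precat \<Rightarrow> ('o, 'm, 'e) bifun \<Rightarrow> 'o \<Rightarrow> 'm \<Rightarrow> 'e \<Rightarrow> 'e" where
  "push \<C> \<E> C a \<delta> = Emap \<E> (ident \<C> C) a \<delta>"

definition pull ::
  "('o, 'm) precat \<Rightarrow> ('o, 'm, 'e) bifun \<Rightarrow> 'o \<Rightarrow> 'm \<Rightarrow> 'e \<Rightarrow> 'e" where
  "pull \<C> \<E> A c \<delta> = Emap \<E> c (ident \<C> A) \<delta>"

text \<open>\<open>(a, c)\<close> is a morphism of extensions from \<open>\<delta> \<in> \<E>(C, A)\<close> to \<open>\<delta>' \<in> \<E>(C', A')\<close>.\<close>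

definition ext_morphism ::
  "('o, 'm) precat \<Rightarrow> ('o, 'm, 'e) bifun \<Rightarrow> 'o \<Rightarrow> 'o \<Rightarrow> 'e \<Rightarrow> 'o \<Rightarrow> 'o \<Rightarrow> 'e \<Rightarrow> 'm \<Rightarrow> 'm \<Rightarrow> bool" where
  "ext_morphism \<C> \<E> C A \<delta> C' A' \<delta>' a c \<longleftrightarrow>
     a \<in> carrier (Hom \<C> A A') \<and> c \<in> carrier (Hom \<C> C C') \<and>
     push \<C> \<E> C a \<delta> = pull \<C> \<E> A' c \<delta>'"

text \<open>
  A sequence \<open>A \<rightarrow> B \<rightarrow> C\<close> is encoded as the pair of its two morphisms, which determines \<open>B\<close>.
\<close>

definition sequences :: "('o, 'm) precat \<Rightarrow> 'o \<Rightarrow> 'o \<Rightarrow> ('m \<times> 'm) set" where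
  "sequences \<C> A C =
     {(x, y). \<exists>B \<in> Obj \<C>. x \<in> carrier (Hom \<C> A B) \<and> y \<in> carrier (Hom \<C> B C)}"

definition seq_equiv :: "('o, 'm) precat \<Rightarrow> 'o \<Rightarrow> 'o \<Rightarrow> (('m \<times> 'm) \<times> ('m \<times> 'm)) set" where
  "seq_equiv \<C> A C =
     {((x, y), (x', y')). \<exists>B \<in> Obj \<C>. \<exists>B' \<in> Obj \<C>. \<exists>b \<in> isos \<C> B B'.
        x \<in> carrier (Hom \<C> A B) \<and> y \<in> carrier (Hom \<C> B C) \<and>
        x' \<in> carrier (Hom \<C> A B') \<and> y' \<in> carrier (Hom \<C> B' C) \<and>
        b \<cdot>\<^bsub>\<C>\<^esub> x = x' \<and> y' \<cdot>\<^bsub>\<C>\<^esub> b = y}"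

definition seq_class :: "('o, 'm) precat \<Rightarrow> 'o \<Rightarrow> 'o \<Rightarrow> 'm \<Rightarrow> 'm \<Rightarrow> ('m \<times> 'm) set" where
  "seq_class \<C> A C x y = seq_equiv \<C> A C `` {(x, y)}"

text \<open>
  The matrix \<open>f \<oplus> f' : P \<rightarrow> Q\<close>, where \<open>p, p'\<close> are the projections of the biproduct \<open>P\<close> of the
  domains and \<open>j, j'\<close> the injections of the biproduct \<open>Q\<close> of the codomains.
\<close>

definition mor_sum ::
  "('o, 'm) precat \<Rightarrow> 'o \<Rightarrow> 'o \<Rightarrow> 'm \<Rightarrow> 'm \<Rightarrow> 'm \<Rightarrow> 'm \<Rightarrow> 'm \<Rightarrow> 'm \<Rightarrow> 'm" where
  "mor_sum \<C> P Q p p' j j' f f' =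
     (j \<cdot>\<^bsub>\<C>\<^esub> f \<cdot>\<^bsub>\<C>\<^esub> p) \<otimes>\<^bsub>Hom \<C> P Q\<^esub> (j' \<cdot>\<^bsub>\<C>\<^esub> f' \<cdot>\<^bsub>\<C>\<^esub> p')"

text \<open>
  \<open>\<epsilon> \<in> \<E>(C \<oplus> C', A \<oplus> A')\<close> is \<open>\<delta> \<oplus> \<delta>'\<close>: its components in \<open>\<E>(C, A)\<close>, \<open>\<E>(C, A')\<close>,
  \<open>\<E>(C', A)\<close>, \<open>\<E>(C', A')\<close> are \<open>\<delta>, 0, 0, \<delta>'\<close>. Here \<open>i, i'\<close> are the injections of \<open>C \<oplus> C'\<close> and
  \<open>p, p'\<close> the projections of \<open>A \<oplus> A'\<close>.
\<close>

definition is_ext_sum ::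
  "('o, 'm, 'e) bifun \<Rightarrow> 'o \<Rightarrow> 'o \<Rightarrow> 'o \<Rightarrow> 'o \<Rightarrow> 'm \<Rightarrow> 'm \<Rightarrow> 'm \<Rightarrow> 'm \<Rightarrow> 'e \<Rightarrow> 'e \<Rightarrow> 'e \<Rightarrow> bool"
  where
  "is_ext_sum \<E> C C' A A' i i' p p' \<delta> \<delta>' \<epsilon> \<longleftrightarrow>
     Emap \<E> i p \<epsilon> = \<delta> \<and> Emap \<E> i p' \<epsilon> = \<one>\<^bsub>Ext \<E> C A'\<^esub> \<and>
     Emap \<E> i' p \<epsilon> = \<one>\<^bsub>Ext \<E> C' A\<^esub> \<and> Emap \<E> i' p' \<epsilon> = \<delta>'"

text \<open>
  \<open>\<ss> C A \<delta>\<close> is the equivalence class of sequences attached to \<open>\<delta> \<in> \<E>(C, A)\<close>, and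
  \<open>realizes \<C> \<E> \<ss> A B C x y \<delta>\<close> says that \<open>\<delta> \<in> \<E>(C, A)\<close> and \<open>\<ss>(\<delta>) = [A \<rightarrow> B \<rightarrow> C]\<close>, with
  \<open>x : A \<rightarrow> B\<close> and \<open>y : B \<rightarrow> C\<close>.
\<close>

definition realizes ::
  "('o, 'm) precat \<Rightarrow> ('o, 'm, 'e) bifun \<Rightarrow> ('o \<Rightarrow> 'o \<Rightarrow> 'e \<Rightarrow> ('m \<times> 'm) set) \<Rightarrow>
   'o \<Rightarrow> 'o \<Rightarrow> 'o \<Rightarrow> 'm \<Rightarrow> 'm \<Rightarrow> 'e \<Rightarrow> bool" where
  "realizes \<C> \<E> \<ss> A B C x y \<delta> \<longleftrightarrow>
     A \<in> Obj \<C> \<and> B \<in> Obj \<C> \<and> C \<in> Obj \<C> \<and> \<delta> \<in> carrier (Ext \<E> C A) \<and>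
     x \<in> carrier (Hom \<C> A B) \<and> y \<in> carrier (Hom \<C> B C) \<and>
     \<ss> C A \<delta> = seq_class \<C> A C x y"

locale realization = additive_bifunctor \<C> \<E>
  for \<C> :: "('o, 'm) precat" (structure) and \<E> :: "('o, 'm, 'e) bifun" +
  fixes \<ss> :: "'o \<Rightarrow> 'o \<Rightarrow> 'e \<Rightarrow> ('m \<times> 'm) set"
  assumes realization_class:
      "\<lbrakk>C \<in> Obj \<C>; A \<in> Obj \<C>; \<delta> \<in> carrier (Ext \<E> C A)\<rbrakk>
        \<Longrightarrow> \<ss> C A \<delta> \<in> sequences \<C> A C // seq_equiv \<C> A C"
    and realization_morphism:
      "\<lbrakk>realizes \<C> \<E> \<ss> A B C x y \<delta>; realizes \<C> \<E> \<ss> A' B' C' x' y' \<delta>';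
        ext_morphism \<C> \<E> C A \<delta> C' A' \<delta>' a c\<rbrakk>
        \<Longrightarrow> \<exists>b \<in> carrier (Hom \<C> B B'). b \<cdot> x = x' \<cdot> a \<and> y' \<cdot> b = c \<cdot> y"

text \<open>
  Direct sums are only determined up to isomorphism; the two conditions are imposed for all choices
  of biproducts, on which the equivalence classes do not depend.
\<close>

locale additive_realization = realization +
  assumes realization_split:
      "biproduct \<C> A C P i\<^sub>A i\<^sub>C p\<^sub>A p\<^sub>C \<Longrightarrow> \<ss> C A \<one>\<^bsub>Ext \<E> C A\<^esub> = seq_class \<C> A C i\<^sub>A p\<^sub>C"
    and realization_sum:
      "\<lbrakk>realizes \<C> \<E> \<ss> A B C x y \<delta>; realizes \<C> \<E> \<ss> A' B' C' x' y' \<delta>';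
        biproduct \<C> A A' S\<^sub>A i\<^sub>A i\<^sub>A' p\<^sub>A p\<^sub>A'; biproduct \<C> B B' S\<^sub>B i\<^sub>B i\<^sub>B' p\<^sub>B p\<^sub>B';
        biproduct \<C> C C' S\<^sub>C i\<^sub>C i\<^sub>C' p\<^sub>C p\<^sub>C';
        \<epsilon> \<in> carrier (Ext \<E> S\<^sub>C S\<^sub>A); is_ext_sum \<E> C C' A A' i\<^sub>C i\<^sub>C' p\<^sub>A p\<^sub>A' \<delta> \<delta>' \<epsilon>\<rbrakk>
        \<Longrightarrow> \<ss> S\<^sub>C S\<^sub>A \<epsilon> =
          seq_class \<C> S\<^sub>A S\<^sub>C (mor_sum \<C> S\<^sub>A S\<^sub>B p\<^sub>A p\<^sub>A' i\<^sub>B i\<^sub>B' x x')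
            (mor_sum \<C> S\<^sub>B S\<^sub>C p\<^sub>B p\<^sub>B' i\<^sub>C i\<^sub>C' y y')"


section \<open>Extriangulated categories\<close>

text \<open>
  (ET1) and (ET2) are the underlying locales \<open>additive_bifunctor\<close> and \<open>additive_realization\<close>.
\<close>

locale extriangulated_category = additive_realization +
  assumes ET3:
      "\<lbrakk>realizes \<C> \<E> \<ss> A B C x y \<delta>; realizes \<C> \<E> \<ss> A' B' C' x' y' \<delta>';
        a \<in> carrier (Hom \<C> A A'); b \<in> carrier (Hom \<C> B B'); b \<cdot> x = x' \<cdot> a\<rbrakk>
        \<Longrightarrow> \<exists>c. ext_morphism \<C> \<E> C A \<delta> C' A' \<delta>' a c \<and> c \<cdot> y = y' \<cdot> b"
    and ET3_op:
      "\<lbrakk>realizes \<C> \<E> \<ss> A B C x y \<delta>; realizes \<C> \<E> \<ss> A' B' C' x' y' \<delta>';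
        b \<in> carrier (Hom \<C> B B'); c \<in> carrier (Hom \<C> C C'); c \<cdot> y = y' \<cdot> b\<rbrakk>
        \<Longrightarrow> \<exists>a. ext_morphism \<C> \<E> C A \<delta> C' A' \<delta>' a c \<and> b \<cdot> x = x' \<cdot> a"
    and ET4:
      "\<lbrakk>realizes \<C> \<E> \<ss> A B D f f' \<delta>; realizes \<C> \<E> \<ss> B C F g g' \<delta>'\<rbrakk>
        \<Longrightarrow> \<exists>E h h' d e \<delta>''.
          realizes \<C> \<E> \<ss> A C E h h' \<delta>'' \<and>
          d \<in> carrier (Hom \<C> D E) \<and> e \<in> carrier (Hom \<C> E F) \<and>
          h = g \<cdot> f \<and> h' \<cdot> g = d \<cdot> f' \<and> g' = e \<cdot> h' \<and>
          realizes \<C> \<E> \<ss> D E F d e (push \<C> \<E> F f' \<delta>') \<and>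
          pull \<C> \<E> A d \<delta>'' = \<delta> \<and>
          push \<C> \<E> E f \<delta>'' = pull \<C> \<E> B e \<delta>'"
    and ET4_op:
      "\<lbrakk>realizes \<C> \<E> \<ss> D A B f' f \<delta>; realizes \<C> \<E> \<ss> F B C g' g \<delta>'\<rbrakk>
        \<Longrightarrow> \<exists>E h h' d e \<delta>''.
          realizes \<C> \<E> \<ss> E A C h' h \<delta>'' \<and>
          d \<in> carrier (Hom \<C> D E) \<and> e \<in> carrier (Hom \<C> E F) \<and>
          h = g \<cdot> f \<and> f \<cdot> h' = g' \<cdot> e \<and> f' = h' \<cdot> d \<and>
          realizes \<C> \<E> \<ss> D E F d e (pull \<C> \<E> D g' \<delta>) \<and>
          push \<C> \<E> C e \<delta>'' = \<delta>' \<and>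
          push \<C> \<E> B d \<delta> = pull \<C> \<E> E g \<delta>''"


section \<open>Torsion pairs\<close>

text \<open>A full subcategory is given by its set of objects.\<close>

definition torsion_pair :: "('o, 'm) precat \<Rightarrow> 'o set \<Rightarrow> 'o set \<Rightarrow> bool" where
  "torsion_pair \<C> T F \<longleftrightarrow> T \<subseteq> Obj \<C> \<and> F \<subseteq> Obj \<C> \<and>
     (\<forall>t \<in> Obj \<C>. (\<forall>f \<in> F. carrier (Hom \<C> t f) = {\<one>\<^bsub>Hom \<C> t f\<^esub>}) \<longleftrightarrow> t \<in> T) \<and>
     (\<forall>f \<in> Obj \<C>. (\<forall>t \<in> T. carrier (Hom \<C> t f) = {\<one>\<^bsub>Hom \<C> t f\<^esub>}) \<longleftrightarrow> f \<in> F)"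

definition torsion_pairs :: "('o, 'm) precat \<Rightarrow> ('o set \<times> 'o set) gorder" where
  "torsion_pairs \<C> =
     \<lparr>carrier = {(T, F). torsion_pair \<C> T F}, eq = (=), le = (\<lambda>(T\<^sub>1, F\<^sub>1) (T\<^sub>2, F\<^sub>2). T\<^sub>1 \<subseteq> T\<^sub>2)\<rparr>"

lemma torsion_pair_subset_iff:
  assumes "torsion_pair \<C> T\<^sub>1 F\<^sub>1" and "torsion_pair \<C> T\<^sub>2 F\<^sub>2"
  shows "T\<^sub>1 \<subseteq> T\<^sub>2 \<longleftrightarrow> F\<^sub>2 \<subseteq> F\<^sub>1"
  using assms unfolding torsion_pair_def subset_iff by metis

end

theory Submission
  imports Defs
begin

text \<open>
  Torsion pairs are the closed pairs of the Galois connection between sets of objects given by the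
  relation \<open>Hom(t, f) = 0\<close>. An intersection of closed sets is closed, so \<open>T\<^sub>1 \<inter> T\<^sub>2\<close> is the torsion
  class of the meet and \<open>F\<^sub>1 \<inter> F\<^sub>2\<close> the torsion-free class of the join.
\<close>

definition hom_zero :: "('o, 'm) precat \<Rightarrow> 'o \<Rightarrow> 'o \<Rightarrow> bool" where
  "hom_zero \<C> t f \<longleftrightarrow> carrier (Hom \<C> t f) = {\<one>\<^bsub>Hom \<C> t f\<^esub>}"

definition right_perp :: "('o, 'm) precat \<Rightarrow> 'o set \<Rightarrow> 'o set" where
  "right_perp \<C> T = {f \<in> Obj \<C>. \<forall>t \<in> T. hom_zero \<C> t f}"

definition left_perp :: "('o, 'm) precat \<Rightarrow> 'o set \<Rightarrow> 'o set" where
  "left_perp \<C> F = {t \<in> Obj \<C>. \<forall>f \<in> F. hom_zero \<C> t f}"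

text \<open>Torsion pairs become the fixed pairs of a Galois connection. The inclusions in
  \<open>Obj \<C>\<close> are absorbed, since both perps consist of objects.\<close>

lemma torsion_pair_iff_perp:
  "torsion_pair \<C> T F \<longleftrightarrow> T = left_perp \<C> F \<and> F = right_perp \<C> T"
  unfolding torsion_pair_def left_perp_def right_perp_def hom_zero_def by blast

text \<open>The triple perp collapses to a single one: \<open>T\<close> lies in its double perp, so
  the right perp of the double perp is no larger than that of \<open>T\<close>. The hypothesis on
  \<open>T\<close> is what puts it inside its double perp.\<close>

lemma torsion_pair_left_perp_right_perp:
  assumes "T \<subseteq> Obj \<C>"
  shows "torsion_pair \<C> (left_perp \<C> (right_perp \<C> T)) (right_perp \<C> T)"
  using assms unfolding torsion_pair_iff_perp left_perp_def right_perp_def by blast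

lemma torsion_pair_right_perp_left_perp:
  assumes "F \<subseteq> Obj \<C>"
  shows "torsion_pair \<C> (left_perp \<C> F) (right_perp \<C> (left_perp \<C> F))"
  using assms unfolding torsion_pair_iff_perp left_perp_def right_perp_def by blast

lemma torsion_pair_inter_torsion:
  assumes "torsion_pair \<C> T\<^sub>1 F\<^sub>1" and "torsion_pair \<C> T\<^sub>2 F\<^sub>2"
  shows "torsion_pair \<C> (T\<^sub>1 \<inter> T\<^sub>2) (right_perp \<C> (T\<^sub>1 \<inter> T\<^sub>2))"
proof -
  \<comment> \<open>A perp turns unions into intersections, so the intersection is itself a perp and
    hence closed.\<close>
  have "T\<^sub>1 \<inter> T\<^sub>2 = left_perp \<C> (F\<^sub>1 \<union> F\<^sub>2)" and "F\<^sub>1 \<union> F\<^sub>2 \<subseteq> Obj \<C>"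
    using assms unfolding torsion_pair_iff_perp left_perp_def right_perp_def by blast+
  then show ?thesis
    using torsion_pair_right_perp_left_perp by metis
qed

lemma torsion_pair_inter_torsion_free:
  assumes "torsion_pair \<C> T\<^sub>1 F\<^sub>1" and "torsion_pair \<C> T\<^sub>2 F\<^sub>2"
  shows "torsion_pair \<C> (left_perp \<C> (F\<^sub>1 \<inter> F\<^sub>2)) (F\<^sub>1 \<inter> F\<^sub>2)"
proof -
  have "F\<^sub>1 \<inter> F\<^sub>2 = right_perp \<C> (T\<^sub>1 \<union> T\<^sub>2)" and "T\<^sub>1 \<union> T\<^sub>2 \<subseteq> Obj \<C>"
    using assms unfolding torsion_pair_iff_perp left_perp_def right_perp_def by blast+
  then show ?thesis
    using torsion_pair_left_perp_right_perp by metis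
qed

lemma torsion_pairs_simps [simp]:
  "carrier (torsion_pairs \<C>) = {(T, F). torsion_pair \<C> T F}"
  "X .=\<^bsub>torsion_pairs \<C>\<^esub> Y \<longleftrightarrow> X = Y"
  "X \<sqsubseteq>\<^bsub>torsion_pairs \<C>\<^esub> Y \<longleftrightarrow> fst X \<subseteq> fst Y"
  by (auto simp: torsion_pairs_def split: prod.splits)

text \<open>The order compares torsion classes only; antisymmetry holds because the torsion class
  determines the torsion-free class as its right perp.\<close>

lemma partial_order_torsion_pairs: "partial_order (torsion_pairs \<C>)"
proof
  fix X Y
  assume "X \<sqsubseteq>\<^bsub>torsion_pairs \<C>\<^esub> Y" "Y \<sqsubseteq>\<^bsub>torsion_pairs \<C>\<^esub> X"
    "X \<in> carrier (torsion_pairs \<C>)" "Y \<in> carrier (torsion_pairs \<C>)"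
  then show "X .=\<^bsub>torsion_pairs \<C>\<^esub> Y"
    by (auto simp: torsion_pair_iff_perp)
qed (auto simp: torsion_pairs_def)

lemma lattice_torsion_pairs: "Lattice.lattice (torsion_pairs \<C>)"
proof -
  interpret partial_order "torsion_pairs \<C>"
    by (rule partial_order_torsion_pairs)
  show ?thesis
  proof
    fix X Y
    assume "X \<in> carrier (torsion_pairs \<C>)" "Y \<in> carrier (torsion_pairs \<C>)"
    then obtain T\<^sub>1 F\<^sub>1 T\<^sub>2 F\<^sub>2 where X: "X = (T\<^sub>1, F\<^sub>1)" and Y: "Y = (T\<^sub>2, F\<^sub>2)"
      and tp: "torsion_pair \<C> T\<^sub>1 F\<^sub>1" "torsion_pair \<C> T\<^sub>2 F\<^sub>2"
      by auto
    note join = torsion_pair_inter_torsion_free [OF tp]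
    \<comment> \<open>The inclusions of \<open>F\<^sub>1 \<inter> F\<^sub>2\<close> in
      \<open>F\<^sub>1\<close> and \<open>F\<^sub>2\<close>, reversed by passing to torsion
      classes.\<close>
    have upper: "T\<^sub>1 \<subseteq> left_perp \<C> (F\<^sub>1 \<inter> F\<^sub>2)" "T\<^sub>2 \<subseteq> left_perp \<C> (F\<^sub>1 \<inter> F\<^sub>2)"
      using torsion_pair_subset_iff [OF tp(1) join] torsion_pair_subset_iff [OF tp(2) join]
      by simp_all
    have "least (torsion_pairs \<C>) (left_perp \<C> (F\<^sub>1 \<inter> F\<^sub>2), F\<^sub>1 \<inter> F\<^sub>2)
      (Upper (torsion_pairs \<C>) {X, Y})"
    proof (rule least_UpperI)
      fix Z
      assume "Z \<in> Upper (torsion_pairs \<C>) {X, Y}"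
      then obtain T F where Z: "Z = (T, F)" and "torsion_pair \<C> T F" "T\<^sub>1 \<subseteq> T" "T\<^sub>2 \<subseteq> T"
        using tp by (auto simp: Upper_def X Y)
      \<comment> \<open>Minimality is checked on torsion-free classes, where the join is a plain
        intersection, and then carried back to torsion classes.\<close>
      then have "F \<subseteq> F\<^sub>1 \<inter> F\<^sub>2"
        using tp torsion_pair_subset_iff by blast
      then show "(left_perp \<C> (F\<^sub>1 \<inter> F\<^sub>2), F\<^sub>1 \<inter> F\<^sub>2) \<sqsubseteq>\<^bsub>torsion_pairs \<C>\<^esub> Z"
        using torsion_pair_subset_iff [OF join \<open>torsion_pair \<C> T F\<close>] by (simp add: Z)
    qed (use tp join upper in \<open>auto simp: X Y\<close>)
    then show "\<exists>s. least (torsion_pairs \<C>) s (Upper (torsion_pairs \<C>) {X, Y})" ..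
    \<comment> \<open>No order reversal is needed here: the order is inclusion of first components,
      and the meet has \<open>T\<^sub>1 \<inter> T\<^sub>2\<close> there.\<close>
    have "greatest (torsion_pairs \<C>) (T\<^sub>1 \<inter> T\<^sub>2, right_perp \<C> (T\<^sub>1 \<inter> T\<^sub>2))
      (Lower (torsion_pairs \<C>) {X, Y})"
      using tp torsion_pair_inter_torsion [OF tp]
      by (auto simp: greatest_def Lower_def X Y)
    then show "\<exists>s. greatest (torsion_pairs \<C>) s (Lower (torsion_pairs \<C>) {X, Y})" ..
  qed
qed

theorem theorem4p10:
  fixes \<C> :: "('o, 'm) precat"
    and \<E> :: "('o, 'm, 'e) bifun"
    and \<ss> :: "'o \<Rightarrow> 'o \<Rightarrow> 'e \<Rightarrow> ('m \<times> 'm) set"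
  assumes "extriangulated_category \<C> \<E> \<ss>"
  shows "Lattice.lattice (torsion_pairs \<C>)"
  by (rule lattice_torsion_pairs)

end
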